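(* Let $q\in\mathbb{C}\setminus\{0\}$ with $|q|\neq1$. Let $m\in\mathbb{N}$, $m\geq2$, and let $f_1,\ldots,f_{m+1}\in\mathbb{C}[z]$ be pairwise relatively $q$-prime polynomials with $\min_{1\leq i\leq m+1}\{\deg f_i\}\geq m-1$ satisfying the functional equation $$f_1+\cdots+f_m=f_{m+1},$$ and such that $f_1,\dots,f_m$ are linearly independent over $\mathbb{C}$. Then $$\max_{1\leq i\leq m+1}\{\deg f_i\}\leq \deg\big(\mathrm{rad}_q^{m-1}(f_1f_2\cdots f_{m+1})\big)-\frac{1}{2}m(m-1)\leq (m-1)\deg\big(\mathrm{rad}_q(f_1f_2\cdots f_{m+1})\big)-\frac{1}{2}m(m-1).$$
   Context: For $w\in\mathbb{C}$: $[z-w]_q^0=1$ and $[z-w]_q^n=(z-w)(z-wq)\cdots(z-wq^{n-1})$ for $n\ge 1$ (so $[z-0]_q^n=z^n$). The $q$-derivative is $D_qf(z)=\frac{f(qz)-f(z)}{qz-z}$ for $z\neq 0$, and $D_qf(0)=f'(0)$; $D_q^0f=f$, $D_q^nf=D_q^{n-1}(D_qf)$. A point $z_0$ is a zero of $f$ with $q$-weight $n$ if $D_q^kf(z_0)=0$ for all $0\le k<n$, but $D_q^nf(z_0)\neq0$ (infinite $q$-weight if $D_q^kf(z_0)=0$ for all $k\ge0$). $q$-difference radical: let $P$ be a nonzero polynomial. Choose a zero $z_1$ of $P$ with $P(q^{-1}z_1)\neq0$, of $q$-weight $n_1$, and write $P(z)=[z-z_1]_q^{n_1}P_1(z)$ with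 $P_1(q^{n_1}z_1)\ne0$; then choose a zero $z_2$ of $P_1$ with $P_1(q^{-1}z_2)\ne0$, of $q$-weight $n_2$ as a zero of $P_1$, write $P_1(z)=[z-z_2]_q^{n_2}P_2(z)$, and so on. A zero at the origin of multiplicity $n$ contributes the single factor $[z-0]_q^n=z^n$. This gives a representation, unique up to order, $$P(z)=A\prod_{j=1}^N[z-z_j]_q^{n_j},\qquad A\neq0,$$ where $z_j=z_k$ is possible for $j\neq k$. Then $\mathrm{rad}_q(P)=\prod_{j=1}^N(z-z_j)$, and the $q$-radical of truncation level $\mu\in\mathbb{N}$ is $$\mathrm{rad}_q^\mu(P)=\gcd\Big(\prod_{j=1}^N[z-z_j]_q^{n_j},\ \prod_{j=1}^N[z-z_j]_q^{\mu}\Big).$$ Common $q$-divisor: for entire $f,g$, the linear factor $z-z_0$ is a common $q$-divisor of $f$ and $g$ if there are a zero $z_1$ of $f$ with $q$-weight $k\geq 1$, a zero $z_2$ of $g$ with $q$-weight $l\geq 1$ ($q$-weights possibly infinite), integers $1\le k_1\le k$, $1\le l_1\le l$, and entire functions $F,G$ with $f(z)=[z-z_1]_q^{k_1}F(z)$, $g(z)=[z-z_2]_q^{l_1}G(z)$, such that $z_0\in\{z_1,z_2\}$ and $f(z)g(z)=[z-z_0]_q^{k_1+l_1}F(z)G(z)$. (If $z_0=z_1$ this means $z_2=q^{k_1}z_1$; if $z_0=z_2$ it means $z_1=q^{l_1}z_2$.) Two functions are relatively $q$-prime if they have no nonconstant common $q$-divisor. *)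

theory Defs
  imports "HOL-Complex_Analysis.Complex_Analysis"
    "HOL-Computational_Algebra.Polynomial_Factorial" "HOL-Computational_Algebra.Field_as_Ring"
    "HOL-Library.Extended_Nat" "HOL-Library.Multiset"
begin

(* [z - w]_q^n as a polynomial in z *)
definition qpow :: "complex \<Rightarrow> complex \<Rightarrow> nat \<Rightarrow> complex poly" where
  "qpow q w n = (\<Prod>k<n. [:- (w * q ^ k), 1:])"

definition qderiv :: "complex \<Rightarrow> (complex \<Rightarrow> complex) \<Rightarrow> complex \<Rightarrow> complex" where
  "qderiv q f z = (if z = 0 then deriv f 0 else (f (q * z) - f z) / (q * z - z))"

(* A point that is not a zero of f has q-weight 0. *)
definition qweight :: "complex \<Rightarrow> (complex \<Rightarrow> complex) \<Rightarrow> complex \<Rightarrow> enat" where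
  "qweight q f z = (if \<forall>k. (qderiv q ^^ k) f z = 0 then \<infinity>
                    else enat (LEAST k. (qderiv q ^^ k) f z \<noteq> 0))"

(* qfactors q P M: some run of the factorization procedure ends in
   P(z) = A * prod_j [z - z_j]_q^(n_j) with A nonzero, and M is the multiset of the
   pairs (z_j, n_j); a pair may occur repeatedly.  The rule chain never applies
   to a zero at the origin, since 0 / q = 0. *)
inductive qfactors :: "complex \<Rightarrow> complex poly \<Rightarrow> (complex \<times> nat) multiset \<Rightarrow> bool"
  for q :: complex where
  const: "A \<noteq> 0 \<Longrightarrow> qfactors q [:A:] {#}"
| chain: "\<lbrakk>poly P w = 0; poly P (w / q) \<noteq> 0; qweight q (poly P) w = enat n;
           P = qpow q w n * P1; poly P1 (q ^ n * w) \<noteq> 0; qfactors q P1 M\<rbrakk>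
          \<Longrightarrow> qfactors q P (add_mset (w, n) M)"
| origin: "\<lbrakk>P \<noteq> 0; poly P 0 = 0; order 0 P = n; P = qpow q 0 n * P1; qfactors q P1 M\<rbrakk>
          \<Longrightarrow> qfactors q P (add_mset (0, n) M)"

(* For P nonzero, q nonzero and |q| \<noteq> 1 the multiset exists and is unique (the
   representation is unique up to order), so the choice is immaterial there. *)
definition qzeros :: "complex \<Rightarrow> complex poly \<Rightarrow> (complex \<times> nat) multiset" where
  "qzeros q P = (SOME M. qfactors q P M)"

definition qrad :: "complex \<Rightarrow> complex poly \<Rightarrow> complex poly" where
  "qrad q P = (\<Prod>(w, n)\<in>#qzeros q P. [:- w, 1:])"

definition qrad_trunc :: "complex \<Rightarrow> nat \<Rightarrow> complex poly \<Rightarrow> complex poly" where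
  "qrad_trunc q \<mu> P =
     gcd (\<Prod>(w, n)\<in>#qzeros q P. qpow q w n) (\<Prod>(w, n)\<in>#qzeros q P. qpow q w \<mu>)"

(* z - z0 is a common q-divisor of the entire functions f and g *)
definition common_qdivisor ::
    "complex \<Rightarrow> (complex \<Rightarrow> complex) \<Rightarrow> (complex \<Rightarrow> complex) \<Rightarrow> complex \<Rightarrow> bool" where
  "common_qdivisor q f g z0 \<longleftrightarrow>
     (\<exists>z1 z2 k l F G.
        1 \<le> k \<and> enat k \<le> qweight q f z1 \<and> 1 \<le> l \<and> enat l \<le> qweight q g z2 \<and>
        F holomorphic_on UNIV \<and> G holomorphic_on UNIV \<and>
        (\<forall>z. f z = poly (qpow q z1 k) z * F z) \<and>
        (\<forall>z. g z = poly (qpow q z2 l) z * G z) \<and>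
        z0 \<in> {z1, z2} \<and>
        (\<forall>z. f z * g z = poly (qpow q z0 (k + l)) z * F z * G z))"

(* Common q-divisors are linear factors by definition, hence never constant. *)
definition rel_qprime :: "complex \<Rightarrow> (complex \<Rightarrow> complex) \<Rightarrow> (complex \<Rightarrow> complex) \<Rightarrow> bool" where
  "rel_qprime q f g \<longleftrightarrow> \<not> (\<exists>z0. common_qdivisor q f g z0)"

end

theory Submission
  imports Defs "Jordan_Normal_Form.Determinant"
    "HOL-Computational_Algebra.Fundamental_Theorem_Algebra"
begin

text \<open>
  The proof is the Wronskian proof of the Mason-Stothers theorem, with q-derivatives in place of
  derivatives. Let \<open>W\<close> be the determinant of the first \<open>m\<close> q-derivatives (orders \<open>0\<close> to
  \<open>m - 1\<close>) of \<open>f\<^sub>1, \<dots>, f\<^sub>m\<close>. It is nonzero by linear independence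
  (\<open>qwronskian_nonzero\<close>), and by the functional equation any one of its columns may be replaced
  by \<open>f\<^sub>m\<^sub>+\<^sub>1\<close> (\<open>qwronskian_sum_column\<close>). Its degree can therefore be estimated with any
  chosen \<open>f\<^sub>l\<close> left out: it is at most the degree of \<open>P = f\<^sub>1 \<dots> f\<^sub>m\<^sub>+\<^sub>1\<close> minus
  \<open>deg f\<^sub>l\<close> minus \<open>0 + 1 + \<dots> + (m - 1)\<close>, since each q-derivative lowers the degree
  (\<open>degree_qwronskian\<close>).

  On the other side, \<open>P\<close> is a product of chains \<open>[z - w]_q^n\<close>. If \<open>p \<noteq> 0\<close> belongs to such a chain
  shortened to length \<open>n - (m - 1)\<close>, then \<open>p, q p, \<dots>, q^(m-1) p\<close> are all zeros of \<open>P\<close>.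
  Relative q-primeness forbids zeros of different factors at neighbouring points \<open>z\<close> and \<open>q z\<close>, so
  as \<open>m \<ge> 2\<close> all these zeros belong to one and the same \<open>f\<^sub>j\<close>, with the multiplicities
  they have in \<open>P\<close> (\<open>qchain_single_factor\<close>). Every entry in the column of \<open>f\<^sub>j\<close> is, up to a
  power of \<open>z\<close>, a combination of the dilates \<open>f\<^sub>j(q^s z)\<close> with \<open>s < m\<close>, hence divisible by
  the corresponding power of \<open>z - p\<close>. At the origin the same holds with a loss of at most
  \<open>m - 1\<close> orders. So the product \<open>T\<close> of the shortened chains has degree at most
  \<open>deg W\<close>, whereas \<open>deg P - deg T\<close> is at most the degree of the truncated q-radical
  (\<open>degree_le_qrad_trunc\<close>). Comparing the two estimates gives the first inequality; the second
  one only says that each chain contributes at most \<open>m - 1\<close> to the truncated radical.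

  The q-radicals are defined through a choice among the factorizations into chains; that there is
  one to choose is \<open>qfactors_exists\<close>.
\<close>

(* smult denotes scalar multiplication of polynomials throughout, not that of a module record. *)
hide_const (open) Module.smult

section \<open>The q-derivative of polynomials\<close>

text \<open>
  \<open>poly_shift 1\<close> is division by \<open>z\<close>, which leaves no remainder because \<open>f(q z) - f(z)\<close> has
  no constant term. Dividing formally gives the value at the origin without a limit.
\<close>
definition qdiff :: "complex \<Rightarrow> complex poly \<Rightarrow> complex poly" where
  "qdiff q f = smult (1 / (q - 1)) (poly_shift 1 (pcompose f [:0, q:] - f))"

lemma coeff_qdiff: "coeff (qdiff q f) n = (q ^ Suc n - 1) / (q - 1) * coeff f (Suc n)"
  by (simp add: qdiff_def coeff_poly_shift coeff_pcompose_linear diff_divide_distrib algebra_simps)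

lemma qdiff_mult_X:
  assumes "q \<noteq> 1"
  shows "smult (q - 1) (pCons 0 (qdiff q f)) = pcompose f [:0, q:] - f"
proof (rule poly_eqI)
  fix n
  show "coeff (smult (q - 1) (pCons 0 (qdiff q f))) n = coeff (pcompose f [:0, q:] - f) n"
    using assms by (cases n) (simp_all only: coeff_smult coeff_pCons_0 coeff_pCons_Suc coeff_qdiff
        coeff_diff coeff_pcompose_linear, simp_all add: field_simps)
qed

text \<open>
  At \<open>x = q^d\<close> this is the falling q-factorial \<open>[d][d-1]\<dots>[d-i+1]\<close> with \<open>[d] = (q^d - 1)/(q - 1)\<close>,
  the factor by which the \<open>i\<close>-th q-derivative multiplies \<open>z^d\<close>. Writing it as a polynomial of
  degree \<open>i\<close> in \<open>x\<close> makes it possible to count the exponents \<open>d\<close> at which combinations vanish.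
\<close>
definition qfall :: "complex \<Rightarrow> nat \<Rightarrow> complex poly" where
  "qfall q i = (\<Prod>t<i. [:- 1 / (q - 1), 1 / (q ^ t * (q - 1)):])"

lemma coeff_qdiff_funpow:
  assumes "q \<noteq> 0"
  shows "coeff ((qdiff q ^^ i) f) n = poly (qfall q i) (q ^ (n + i)) * coeff f (n + i)"
proof (induction i arbitrary: n)
  case 0
  then show ?case by (simp add: qfall_def)
next
  case (Suc i)
  have "q ^ Suc (n + i) / (q ^ i * (q - 1)) - 1 / (q - 1) = (q ^ Suc n - 1) / (q - 1)"
    using assms by (simp add: power_add diff_divide_distrib)
  moreover have "poly (qfall q (Suc i)) x
      = poly (qfall q i) x * (x / (q ^ i * (q - 1)) - 1 / (q - 1))" for x
    by (simp add: qfall_def algebra_simps)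
  ultimately show ?case
    by (simp add: coeff_qdiff Suc.IH del: power_Suc)
qed

lemma degree_qdiff_funpow:
  assumes "q \<noteq> 0" and "(qdiff q ^^ i) f \<noteq> 0"
  shows "degree ((qdiff q ^^ i) f) + i \<le> degree f"
proof (rule le_degree)
  have "coeff ((qdiff q ^^ i) f) (degree ((qdiff q ^^ i) f)) \<noteq> 0"
    using assms by simp
  then show "coeff f (degree ((qdiff q ^^ i) f) + i) \<noteq> 0"
    unfolding coeff_qdiff_funpow[OF assms(1)] by simp
qed

lemma degree_qfall:
  assumes "q \<noteq> 0" "q \<noteq> 1"
  shows "degree (qfall q i) = i"
  unfolding qfall_def using assms by (subst degree_prod_eq_sum_degree) auto

lemma qfall_nonzero:
  assumes "q \<noteq> 0" "q \<noteq> 1"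
  shows "qfall q i \<noteq> 0"
  unfolding qfall_def using assms by auto

lemma qdiff_funpow_add:
  assumes "q \<noteq> 0"
  shows "(qdiff q ^^ i) (f + g) = (qdiff q ^^ i) f + (qdiff q ^^ i) g"
  by (rule poly_eqI) (simp add: coeff_qdiff_funpow[OF assms] algebra_simps)

lemma qdiff_funpow_sum_smult:
  assumes "q \<noteq> 0"
  shows "(qdiff q ^^ i) (\<Sum>j\<in>S. smult (c j) (g j)) = (\<Sum>j\<in>S. smult (c j) ((qdiff q ^^ i) (g j)))"
  by (rule poly_eqI) (simp add: coeff_qdiff_funpow[OF assms] coeff_sum sum_distrib_left algebra_simps)

text \<open>
  At the origin the q-derivative behaves like the ordinary one: each application lowers the
  order of vanishing by at most one.
\<close>
lemma monom_dvd_qdiff_funpow: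
  assumes "q \<noteq> 0" and "monom 1 n dvd f"
  shows "monom 1 (n - i) dvd (qdiff q ^^ i) f"
  using assms(2) by (simp add: monom_1_dvd_iff' coeff_qdiff_funpow[OF assms(1)])

text \<open>
  Away from the origin, \<open>z^i\<close> times the \<open>i\<close>-th q-derivative of \<open>f\<close> is a linear combination of the
  dilates \<open>f(z), f(q z), \<dots>, f(q^i z)\<close>, so a factor of all of them that is prime to \<open>z\<close> survives.
\<close>
lemma dvd_qdiff_funpow:
  assumes q: "q \<noteq> 0" "q \<noteq> 1" and d: "coprime d [:0, 1:]"
    and "\<And>s. s \<le> i \<Longrightarrow> d dvd pcompose f [:0, q ^ s:]"
  shows "d dvd (qdiff q ^^ i) f"
  using assms(4)
proof (induction i arbitrary: f)
  case 0
  from 0[of 0] show ?case by simp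
next
  case (Suc i)
  have "d dvd pcompose (qdiff q f) [:0, q ^ s:]" if "s \<le> i" for s
  proof -
    have "pcompose (smult (q - 1) (pCons 0 (qdiff q f))) [:0, q ^ s:]
        = pcompose f [:0, q ^ Suc s:] - pcompose f [:0, q ^ s:]"
      by (simp only: qdiff_mult_X[OF q(2)] pcompose_diff flip: pcompose_assoc)
         (simp add: pcompose_pCons mult.commute)
    moreover have "d dvd \<dots>"
      using Suc.prems[of s] Suc.prems[of "Suc s"] that by (intro dvd_diff) auto
    moreover have "pcompose (smult (q - 1) (pCons 0 (qdiff q f))) [:0, q ^ s:]
        = smult ((q - 1) * q ^ s) ([:0, 1:] * pcompose (qdiff q f) [:0, q ^ s:])"
      by (simp add: pcompose_smult pcompose_pCons)
    ultimately have "d dvd smult ((q - 1) * q ^ s) ([:0, 1:] * pcompose (qdiff q f) [:0, q ^ s:])"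
      by simp
    then have "d dvd [:0, 1:] * pcompose (qdiff q f) [:0, q ^ s:]"
      using q by (subst (asm) dvd_smult_iff) auto
    then show ?thesis
      using d by (simp add: coprime_dvd_mult_right_iff del: mult_pCons_left)
  qed
  from Suc.IH[OF this] show ?case
    by (simp add: funpow_swap1)
qed

section \<open>The q-Wronskian determinant\<close>

definition qwronskian :: "complex \<Rightarrow> nat \<Rightarrow> (nat \<Rightarrow> complex poly) \<Rightarrow> complex poly" where
  "qwronskian q m g = det (mat m m (\<lambda>(i, j). (qdiff q ^^ i) (g j)))"

lemma qwronskian_leibniz:
  "qwronskian q m g =
     (\<Sum>p | p permutes {0..<m}. signof p * (\<Prod>i = 0..<m. (qdiff q ^^ i) (g (p i))))"
proof -
  have "(\<Prod>i = 0..<m. mat m m (\<lambda>(i, j). (qdiff q ^^ i) (g j)) $$ (i, p i))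
      = (\<Prod>i = 0..<m. (qdiff q ^^ i) (g (p i)))" if "p permutes {0..<m}" for p
    using permutes_in_image[OF that] by (intro prod.cong) auto
  then show ?thesis
    unfolding qwronskian_def by (subst det_def'[of _ m]) (auto intro!: sum.cong)
qed

text \<open>
  In every nonzero term of the Leibniz expansion the entry from row \<open>i\<close> has lost at least \<open>i\<close>
  degrees, and each column is used once.
\<close>
lemma degree_qwronskian:
  assumes q: "q \<noteq> 0" and W: "qwronskian q m g \<noteq> 0"
  shows "degree (qwronskian q m g) + (\<Sum>i<m. i) \<le> (\<Sum>j<m. degree (g j))"
proof -
  define summand where "summand p = signof p * (\<Prod>i = 0..<m. (qdiff q ^^ i) (g (p i)))" for p
  have W_eq: "qwronskian q m g = (\<Sum>p | p permutes {0..<m}. summand p)"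
    unfolding qwronskian_leibniz summand_def ..
  have bound: "degree (summand p) + (\<Sum>i<m. i) \<le> (\<Sum>j<m. degree (g j))"
    if p: "p permutes {0..<m}" and nz: "summand p \<noteq> 0" for p
  proof -
    have nz': "(qdiff q ^^ i) (g (p i)) \<noteq> 0" if "i < m" for i
      using nz that by (auto simp: summand_def)
    have "degree (summand p) = degree (\<Prod>i = 0..<m. (qdiff q ^^ i) (g (p i)))"
      by (cases "sign p = (1::int)") (auto simp: summand_def sign_def)
    also have "\<dots> = (\<Sum>i = 0..<m. degree ((qdiff q ^^ i) (g (p i))))"
      using nz' by (intro degree_prod_eq_sum_degree) auto
    finally have "degree (summand p) + (\<Sum>i<m. i)
        = (\<Sum>i = 0..<m. degree ((qdiff q ^^ i) (g (p i))) + i)"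
      by (simp add: sum.distrib lessThan_atLeast0)
    also have "\<dots> \<le> (\<Sum>i = 0..<m. degree (g (p i)))"
      using nz' by (intro sum_mono degree_qdiff_funpow[OF q]) auto
    also have "\<dots> = (\<Sum>j<m. degree (g j))"
      using sum.permute[OF p, of "\<lambda>j. degree (g j)"] by (simp add: lessThan_atLeast0 comp_def)
    finally show ?thesis .
  qed
  obtain p where "p permutes {0..<m}" "summand p \<noteq> 0"
    using W unfolding W_eq by (metis (mono_tags, lifting) mem_Collect_eq sum.neutral)
  with bound have le: "(\<Sum>i<m. i) \<le> (\<Sum>j<m. degree (g j))" by fastforce
  have "degree (summand p) \<le> (\<Sum>j<m. degree (g j)) - (\<Sum>i<m. i)" if "p permutes {0..<m}" for p
    using bound[OF that] by (cases "summand p = 0") auto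
  then have "degree (qwronskian q m g) \<le> (\<Sum>j<m. degree (g j)) - (\<Sum>i<m. i)"
    unfolding W_eq by (intro degree_sum_le) (auto simp: finite_permutations)
  with le show ?thesis by linarith
qed

lemma dvd_qwronskian:
  assumes "j < m" and "\<And>i. i < m \<Longrightarrow> d dvd (qdiff q ^^ i) (g j)"
  shows "d dvd qwronskian q m g"
  unfolding qwronskian_leibniz
proof (rule dvd_sum)
  fix p assume "p \<in> {p. p permutes {0..<m}}"
  then have p: "p permutes {0..<m}" by simp
  then obtain i where i: "i \<in> {0..<m}" "p i = j"
    using assms(1) by (metis atLeastLessThan_iff image_iff permutes_image zero_le)
  have "d dvd (\<Prod>i = 0..<m. (qdiff q ^^ i) (g (p i)))"
    using i assms(2)[of i] by (intro dvd_trans[OF _ dvd_prodI[of _ i]]) auto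
  then show "d dvd signof p * (\<Prod>i = 0..<m. (qdiff q ^^ i) (g (p i)))"
    by (rule dvd_mult)
qed

lemma qwronskian_add_column:
  assumes "q \<noteq> 0" "l < m" "k < m" "k \<noteq> l"
  shows "qwronskian q m (g(l := g l + g k)) = qwronskian q m g"
proof -
  let ?A = "mat m m (\<lambda>(i, j). (qdiff q ^^ i) (g j))"
  have "mat m m (\<lambda>(i, j). (qdiff q ^^ i) ((g(l := g l + g k)) j)) = addcol 1 l k ?A"
    using assms by (intro eq_matI) (auto simp: mat_addcol_def qdiff_funpow_add)
  moreover have "det (addcol 1 l k ?A) = det ?A"
    using assms by (intro det_addcol[of _ m]) auto
  ultimately show ?thesis by (simp add: qwronskian_def)
qed

text \<open>
  The remaining summands are multiples of other columns. This is what makes the functional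
  equation usable: a column \<open>f l\<close> may be exchanged for \<open>f (m + 1)\<close>.
\<close>
lemma qwronskian_sum_column:
  assumes "q \<noteq> 0" "l < m"
  shows "qwronskian q m (g(l := \<Sum>k<m. g k)) = qwronskian q m g"
proof -
  have "qwronskian q m (g(l := g l + (\<Sum>k\<in>S. g k))) = qwronskian q m g"
    if "finite S" "S \<subseteq> {..<m} - {l}" for S
    using that
  proof (induction S rule: finite_induct)
    case (insert k S)
    let ?h = "g(l := g l + (\<Sum>k\<in>S. g k))"
    have "g(l := g l + (\<Sum>k\<in>insert k S. g k)) = ?h(l := ?h l + ?h k)"
      using insert by (auto simp: algebra_simps fun_eq_iff)
    moreover have "qwronskian q m (?h(l := ?h l + ?h k)) = qwronskian q m ?h"
      using insert.prems by (intro qwronskian_add_column assms) auto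
    moreover have "qwronskian q m ?h = qwronskian q m g"
      by (rule insert.IH) (use insert.prems in auto)
    ultimately show ?case by (simp only:)
  qed simp
  from this[of "{..<m} - {l}"] show ?thesis
    using assms by (simp add: sum.remove[of "{..<m}" l])
qed

section \<open>The q-Wronskian of independent polynomials is nonzero\<close>

lemma coeff_mult_top:
  fixes u v :: "'a :: comm_semiring_0 poly"
  assumes "degree u \<le> a" and "degree v \<le> b"
  shows "coeff (u * v) (a + b) = coeff u a * coeff v b"
proof -
  have "coeff u i * coeff v (a + b - i) = 0" if "i \<le> a + b" "i \<noteq> a" for i
  proof (cases "i < a")
    case True
    then have "coeff v (a + b - i) = 0" using assms(2) by (intro coeff_eq_0) auto
    then show ?thesis by simp
  next
    case False
    then have "coeff u i = 0" using assms(1) that by (intro coeff_eq_0) auto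
    then show ?thesis by simp
  qed
  then have "(\<Sum>i\<in>{..a + b} - {a}. coeff u i * coeff v (a + b - i)) = 0"
    by (intro sum.neutral) auto
  then show ?thesis
    by (simp add: coeff_mult sum.remove[of "{..a + b}" a])
qed

lemma coeff_mult_qdiff_funpow_top:
  assumes q: "q \<noteq> 0" and v: "degree v \<le> M + i"
  shows "coeff (v * (qdiff q ^^ i) f) (M + degree f)
       = coeff v (M + i) * poly (qfall q i) (q ^ degree f) * lead_coeff f"
proof (cases "i \<le> degree f")
  case True
  have deg: "degree ((qdiff q ^^ i) f) \<le> degree f - i"
    using degree_qdiff_funpow[OF q, of i f] by (cases "(qdiff q ^^ i) f = 0") auto
  have "M + degree f = (M + i) + (degree f - i)" using True by simp
  then show ?thesis
    using coeff_mult_top[OF v deg] True by (simp add: coeff_qdiff_funpow[OF q])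
next
  case False
  then have "(qdiff q ^^ i) f = 0"
    using degree_qdiff_funpow[OF q, of i f] by auto
  moreover have "poly (qfall q i) (q ^ degree f) = 0"
    unfolding qfall_def poly_prod using False q
    by (intro prod_zero) (auto intro!: bexI[of _ "degree f"])
  ultimately show ?thesis by simp
qed

lemma inj_power_complex:
  assumes "q \<noteq> 0" and "cmod q \<noteq> 1"
  shows "inj (\<lambda>n. q ^ n)"
proof (rule injI)
  fix a b :: nat
  assume "q ^ a = q ^ b"
  then have eq: "cmod q ^ a = cmod q ^ b" by (metis norm_power)
  show "a = b"
  proof (cases "cmod q > 1")
    case True
    with eq show ?thesis by (simp add: power_inject_exp)
  next
    case False
    then have "1 < inverse (cmod q)" using assms by (intro one_less_inverse) auto
    moreover have "inverse (cmod q) ^ a = inverse (cmod q) ^ b"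
      using eq by (simp add: power_inverse)
    ultimately show ?thesis by (simp only: power_inject_exp)
  qed
qed

lemma sum_smult_distinct_degree_nonzero:
  fixes c :: "nat \<Rightarrow> complex"
  assumes "\<And>i. i < m \<Longrightarrow> p i \<noteq> 0 \<and> degree (p i) = i" and "i < m" "c i \<noteq> 0"
  shows "(\<Sum>i<m. smult (c i) (p i)) \<noteq> 0"
proof -
  define k where "k = Max {i. i < m \<and> c i \<noteq> 0}"
  have "k \<in> {i. i < m \<and> c i \<noteq> 0}"
    unfolding k_def using assms(2,3) by (intro Max_in) auto
  then have k: "k < m" "c k \<noteq> 0" by auto
  have top: "c i = 0" if "i < m" "i > k" for i
    using that Max_ge[of "{i. i < m \<and> c i \<noteq> 0}" i] unfolding k_def by fastforce
  have "coeff (\<Sum>i<m. smult (c i) (p i)) k = (\<Sum>i<m. if i = k then c k * coeff (p k) k else 0)"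
    unfolding coeff_sum
  proof (rule sum.cong)
    fix i assume "i \<in> {..<m}"
    then show "coeff (smult (c i) (p i)) k = (if i = k then c k * coeff (p k) k else 0)"
      using top[of i] assms(1)[of i] by (cases i k rule: linorder_cases) (auto simp: coeff_eq_0)
  qed simp
  also have "\<dots> = c k * coeff (p k) k" using k by simp
  also have "\<dots> \<noteq> 0" using k assms(1)[of k] by (metis leading_coeff_0_iff mult_eq_0_iff)
  finally show ?thesis by auto
qed

text \<open>
  A nonzero linear q-difference operator of order below \<open>m\<close> with polynomial coefficients acts on
  the top coefficient of a polynomial of degree \<open>d\<close> through a fixed nonzero polynomial \<open>C\<close> of
  degree below \<open>m\<close>, evaluated at \<open>q^d\<close>. Since the powers of \<open>q\<close> are distinct, only fewer
  than \<open>m\<close> degrees can occur in its kernel.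
\<close>
lemma kernel_degrees:
  assumes q: "q \<noteq> 0" "cmod q \<noteq> 1" and v: "i0 < m" "v i0 \<noteq> 0"
  shows "\<exists>S. finite S \<and> card S < m \<and>
           (\<forall>f. f \<noteq> 0 \<longrightarrow> (\<Sum>i<m. v i * (qdiff q ^^ i) f) = 0 \<longrightarrow> degree f \<in> S)"
proof -
  have q1: "q \<noteq> 1" using q by auto
  \<comment> \<open>Multiplying by \<open>z^m\<close> keeps the kernel and makes the degrees at least \<open>m\<close>, so that the
    differences \<open>degree (u i) - i\<close> below do not truncate.\<close>
  define u where "u i = monom 1 m * v i" for i
  have u: "degree (u i) = m + degree (v i)" if "v i \<noteq> 0" for i
    using that by (simp add: u_def degree_mult_eq degree_monom_eq)
  define J where "J = {i. i < m \<and> v i \<noteq> 0}"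
  define M where "M = Max ((\<lambda>i. degree (u i) - i) ` J)"
  have J: "finite J" "J \<noteq> {}" using v by (auto simp: J_def)
  have deg: "degree (u i) \<le> M + i" if "i < m" for i
  proof (cases "v i = 0")
    case False
    then have "degree (u i) - i \<le> M"
      unfolding M_def using J that by (intro Max_ge) (auto simp: J_def)
    then show ?thesis by simp
  qed (simp add: u_def)
  have "M \<in> (\<lambda>i. degree (u i) - i) ` J"
    unfolding M_def using J by (intro Max_in) auto
  then obtain i1 where i1: "i1 < m" "v i1 \<noteq> 0" "M = degree (u i1) - i1"
    by (auto simp: J_def)
  define c where "c i = coeff (u i) (M + i)" for i
  have "M + i1 = degree (u i1)" using i1 u[of i1] by simp
  moreover have "u i1 \<noteq> 0" using i1 by (simp add: u_def)
  ultimately have c: "c i1 \<noteq> 0" by (simp add: c_def)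
  \<comment> \<open>On \<open>f\<close> of degree \<open>d\<close>, the coefficient of \<open>z^(M + d)\<close> in the value of the operator is the
    leading coefficient of \<open>f\<close> times \<open>C(q^d)\<close>.\<close>
  define C where "C = (\<Sum>i<m. smult (c i) (qfall q i))"
  have C: "C \<noteq> 0" unfolding C_def
    using i1 c by (intro sum_smult_distinct_degree_nonzero[of m "qfall q" i1])
      (simp_all add: qfall_nonzero degree_qfall q q1)
  have degC: "degree C \<le> m - 1" unfolding C_def
    using q(1) q1 by (intro degree_sum_le) (auto intro: order_trans[OF degree_smult_le] simp: degree_qfall)
  define S where "S = {d. poly C (q ^ d) = 0}"
  have fin: "finite {x. poly C x = 0}" using C by (rule poly_roots_finite)
  have S_eq: "S = (\<lambda>d. q ^ d) -` {x. poly C x = 0}" by (auto simp: S_def)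
  have inj: "inj (\<lambda>d. q ^ d)" using q by (rule inj_power_complex)
  show ?thesis
  proof (intro exI[of _ S] conjI allI impI)
    show finS: "finite S" unfolding S_eq using fin inj by (rule finite_vimageI)
    have "card S = card ((\<lambda>d. q ^ d) ` S)"
      using inj by (intro card_image[symmetric]) (auto simp: inj_on_def)
    also have "\<dots> \<le> card {x. poly C x = 0}"
      using fin by (intro card_mono) (auto simp: S_def)
    also have "\<dots> \<le> degree C" using C by (rule card_poly_roots_bound)
    finally show "card S < m" using degC v(1) by linarith
  next
    fix f assume f: "f \<noteq> 0" "(\<Sum>i<m. v i * (qdiff q ^^ i) f) = 0"
    have "(\<Sum>i<m. u i * (qdiff q ^^ i) f) = 0"
      using f(2) by (simp add: u_def mult.assoc flip: sum_distrib_left)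
    then have "0 = coeff (\<Sum>i<m. u i * (qdiff q ^^ i) f) (M + degree f)" by simp
    also have "\<dots> = (\<Sum>i<m. c i * poly (qfall q i) (q ^ degree f) * lead_coeff f)"
      unfolding coeff_sum c_def using deg
      by (intro sum.cong coeff_mult_qdiff_funpow_top q) auto
    also have "\<dots> = poly C (q ^ degree f) * lead_coeff f"
      by (simp add: C_def poly_sum sum_distrib_right)
    finally show "degree f \<in> S" using f(1) by (simp add: S_def)
  qed
qed

text \<open>
  The determinant criterion in terms of functions, which keeps the vector type out of the
  arguments below.
\<close>
lemma singular_matrix_kernel:
  fixes a :: "nat \<times> nat \<Rightarrow> 'a :: idom"
  assumes "det (mat m m a) = 0"
  shows "\<exists>x. (\<exists>k<m. x k \<noteq> 0) \<and> (\<forall>i<m. (\<Sum>j<m. a (i, j) * x j) = 0)"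
proof -
  obtain v where v: "v \<in> carrier_vec m" "v \<noteq> 0\<^sub>v m" "mat m m a *\<^sub>v v = 0\<^sub>v m"
    using det_0_iff_vec_prod_zero[of "mat m m a" m] assms by auto
  obtain k where k: "k < m" "vec_index v k \<noteq> 0"
    using v(1,2) by (metis carrier_vecD eq_vecI index_zero_vec)
  have "(\<Sum>j<m. a (i, j) * vec_index v j) = 0" if "i < m" for i
  proof -
    have "vec_index (mat m m a *\<^sub>v v) i = (\<Sum>j<m. a (i, j) * vec_index v j)"
      using v(1) that by (auto simp: scalar_prod_def lessThan_atLeast0 intro!: sum.cong)
    then show ?thesis using v(3) that by simp
  qed
  with k show ?thesis by (intro exI[of _ "vec_index v"]) auto
qed

lemma nonzero_combination_coeffs_zero:
  fixes g :: "nat \<Rightarrow> complex poly"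
  assumes "finite S" "card S < m"
  shows "\<exists>c. (\<exists>j<m. c j \<noteq> 0) \<and> (\<forall>d\<in>S. (\<Sum>j<m. coeff (g j) d * c j) = 0)"
proof -
  obtain s where s: "bij_betw s {0..<card S} S"
    using ex_bij_betw_nat_finite[OF assms(1)] by blast
  \<comment> \<open>Fewer than \<open>m\<close> equations in \<open>m\<close> unknowns: padding with zero rows gives a singular square
    matrix.\<close>
  define a where "a = (\<lambda>(i, j). if i < card S then coeff (g j) (s i) else 0)"
  have "det (mat m m a) = 0"
  proof -
    have "(\<Prod>i = 0..<m. mat m m a $$ (i, p i)) = 0" if "p permutes {0..<m}" for p
    proof (rule prod_zero)
      \<comment> \<open>Row number \<open>card S\<close> is the first padded row.\<close>
      have "p (card S) < m"
        using permutes_in_image[OF that, of "card S"] assms(2) by simp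
      then have "mat m m a $$ (card S, p (card S)) = 0"
        using assms(2) by (simp add: a_def)
      then show "\<exists>i\<in>{0..<m}. mat m m a $$ (i, p i) = 0"
        using assms(2) by (intro bexI[of _ "card S"]) (assumption, simp)
    qed simp
    then have "signof p * (\<Prod>i = 0..<m. mat m m a $$ (i, p i)) = 0" if "p permutes {0..<m}" for p
      using that by simp
    then show ?thesis
      by (subst det_def'[of _ m], simp) (intro sum.neutral, blast)
  qed
  from singular_matrix_kernel[OF this]
  obtain x j where x: "j < m" "x j \<noteq> 0" "\<forall>i<m. (\<Sum>j<m. a (i, j) * x j) = 0"
    by (elim exE conjE)
  have "(\<Sum>j<m. coeff (g j) d * x j) = 0" if "d \<in> S" for d
  proof -
    have "d \<in> s ` {0..<card S}" using bij_betw_imp_surj_on[OF s] that by simp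
    then obtain i where i: "i < card S" "d = s i" by auto
    show ?thesis
      using x(3)[rule_format, of i] i assms(2) by (simp add: a_def)
  qed
  with x(1,2) show ?thesis by (intro exI[of _ x]) auto
qed

lemma smult_sum_right: "smult c (\<Sum>i\<in>A. h i) = (\<Sum>i\<in>A. smult c (h i))"
  by (induction A rule: infinite_finite_induct) (simp_all add: smult_add_right)

text \<open>
  If the determinant vanished, a nontrivial combination of its rows over the polynomials would be
  zero, that is, one q-difference operator of order below \<open>m\<close> would annihilate the
  \<open>m\<close>-dimensional span of the columns. Elements of that span would have fewer than \<open>m\<close>
  possible degrees \<open>S\<close>, and prescribing zero coefficients at \<open>S\<close> leaves a nontrivial element,
  which cannot exist.
\<close>
lemma qwronskian_nonzero:
  assumes q: "q \<noteq> 0" "cmod q \<noteq> 1"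
    and indep: "\<And>c. (\<Sum>j<m. smult (c j) (g j)) = 0 \<Longrightarrow> \<forall>j<m. c j = 0"
  shows "qwronskian q m g \<noteq> 0"
proof
  assume "qwronskian q m g = 0"
  moreover have "transpose_mat (mat m m (\<lambda>(i, j). (qdiff q ^^ i) (g j)))
      = mat m m (\<lambda>(j, i). (qdiff q ^^ i) (g j))"
    by (intro eq_matI) auto
  ultimately have "det (mat m m (\<lambda>(j, i). (qdiff q ^^ i) (g j))) = 0"
    unfolding qwronskian_def
    using det_transpose[of "mat m m (\<lambda>(i, j). (qdiff q ^^ i) (g j))" m] by simp
  from singular_matrix_kernel[OF this]
  obtain v i0 where i0: "i0 < m" "v i0 \<noteq> 0"
    and v: "\<forall>j<m. (\<Sum>i<m. (case (j, i) of (j, i) \<Rightarrow> (qdiff q ^^ i) (g j)) * v i) = 0"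
    by (elim exE conjE)
  have ker: "(\<Sum>i<m. v i * (qdiff q ^^ i) (g j)) = 0" if "j < m" for j
    using v[rule_format, OF that] by (simp add: mult.commute)
  from kernel_degrees[of q i0 m v, OF q i0]
  obtain S where S: "finite S" "card S < m"
    "\<forall>f. f \<noteq> 0 \<longrightarrow> (\<Sum>i<m. v i * (qdiff q ^^ i) f) = 0 \<longrightarrow> degree f \<in> S"
    by (elim exE conjE)
  from nonzero_combination_coeffs_zero[OF S(1,2), of g]
  obtain c j where c: "j < m" "c j \<noteq> 0" "\<forall>d\<in>S. (\<Sum>j<m. coeff (g j) d * c j) = 0"
    by (elim exE conjE)
  \<comment> \<open>If \<open>f\<close> were nonzero, its degree would lie in \<open>S\<close>, but all its coefficients at \<open>S\<close> vanish.\<close>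
  define f where "f = (\<Sum>j<m. smult (c j) (g j))"
  have "(\<Sum>i<m. v i * (qdiff q ^^ i) f)
      = (\<Sum>i<m. \<Sum>j<m. smult (c j) (v i * (qdiff q ^^ i) (g j)))"
    unfolding f_def qdiff_funpow_sum_smult[OF q(1)] by (simp add: sum_distrib_left)
  also have "\<dots> = (\<Sum>j<m. smult (c j) (\<Sum>i<m. v i * (qdiff q ^^ i) (g j)))"
    unfolding smult_sum_right by (rule sum.swap)
  also have "\<dots> = 0" using ker by simp
  finally have "f \<noteq> 0 \<Longrightarrow> degree f \<in> S" by (intro S(3)[rule_format])
  moreover have "coeff f d = 0" if "d \<in> S" for d
    using c(3)[rule_format, OF that] by (simp add: f_def coeff_sum mult.commute)
  ultimately have "f = 0" by (metis leading_coeff_0_iff)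
  then show False using indep[of c] c(1,2) by (auto simp: f_def)
qed

section \<open>Products of q-chains\<close>

lemma qpow_Suc: "qpow q w (Suc n) = qpow q w n * [:- (w * q ^ n), 1:]"
  by (simp add: qpow_def)

lemma qpow_nonzero [simp]: "qpow q w n \<noteq> 0"
  by (simp add: qpow_def)

lemma degree_qpow [simp]: "degree (qpow q w n) = n"
  unfolding qpow_def by (subst degree_prod_eq_sum_degree) auto

lemma qpow_0_left: "qpow q 0 n = [:0, 1:] ^ n"
  by (simp add: qpow_def)

lemma poly_qpow_eq_0_iff: "poly (qpow q w n) z = 0 \<longleftrightarrow> (\<exists>k<n. z = w * q ^ k)"
  by (auto simp: qpow_def poly_prod)

lemma order_qpow: "order p (qpow q w n) = card {k. k < n \<and> p = w * q ^ k}"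
proof (induction n)
  case 0
  then show ?case by (simp add: qpow_def order_0I)
next
  case (Suc n)
  have "{k. k < Suc n \<and> p = w * q ^ k}
      = (if p = w * q ^ n then insert n {k. k < n \<and> p = w * q ^ k} else {k. k < n \<and> p = w * q ^ k})"
    by (auto simp: less_Suc_eq)
  moreover have "order p [:- (w * q ^ n), 1:] = (if p = w * q ^ n then 1 else 0)"
    using order_power_n_n[of p 1] by (auto intro: order_0I)
  moreover have "order p (qpow q w (Suc n)) = order p (qpow q w n) + order p [:- (w * q ^ n), 1:]"
    unfolding qpow_Suc by (rule order_mult) (simp del: mult_pCons_right)
  ultimately show ?case using Suc.IH by simp
qed

lemma order_qpow_0: 
  assumes "q \<noteq> 0"
  shows "order 0 (qpow q w n) = (if w = 0 then n else 0)"
  using assms by (simp add: order_qpow)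

text \<open>
  If \<open>p\<close> lies in a chain shortened by \<open>\<mu>\<close> at its far end, then its successors up to the
  \<open>\<mu>\<close>-th one still lie in the full chain. A chain at \<open>w = 0\<close> meets only the origin,
  which dilation fixes.
\<close>
lemma order_qpow_shift:
  assumes "q \<noteq> 0" "s \<le> \<mu>"
  shows "order p (qpow q w (n - \<mu>)) \<le> order (q ^ s * p) (qpow q w n)"
  unfolding order_qpow
proof (rule card_inj_on_le)
  show "inj_on (\<lambda>k. k + s) {k. k < n - \<mu> \<and> p = w * q ^ k}" by simp
  show "(\<lambda>k. k + s) ` {k. k < n - \<mu> \<and> p = w * q ^ k} \<subseteq> {k. k < n \<and> q ^ s * p = w * q ^ k}"
    using assms by (auto simp: power_add)
qed simp

text \<open>
  The transformation \<open>h\<close> of the chain lengths covers the polynomial itself (identity), the factors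
  of its truncated radical, and the excess \<open>n - \<mu>\<close> of the chains over the truncation level.
\<close>
definition chain_prod :: "complex \<Rightarrow> (nat \<Rightarrow> nat) \<Rightarrow> (complex \<times> nat) multiset \<Rightarrow> complex poly" where
  "chain_prod q h M = (\<Prod>(w, n)\<in>#M. qpow q w (h n))"

lemma chain_prod_empty [simp]: "chain_prod q h {#} = 1"
  by (simp add: chain_prod_def)

lemma chain_prod_add [simp]:
  "chain_prod q h (add_mset (w, n) M) = qpow q w (h n) * chain_prod q h M"
  by (simp add: chain_prod_def)

lemma chain_prod_nonzero [simp]: "chain_prod q h M \<noteq> 0"
  by (induction M) auto

lemma degree_chain_prod: "degree (chain_prod q h M) = (\<Sum>(w, n)\<in>#M. h n)"
  by (induction M) (auto simp: degree_mult_eq)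

lemma order_chain_prod_shift:
  assumes "q \<noteq> 0" "s \<le> \<mu>"
  shows "order p (chain_prod q (\<lambda>n. n - \<mu>) M) \<le> order (q ^ s * p) (chain_prod q (\<lambda>n. n) M)"
  by (induction M) (auto simp: order_mult intro!: add_mono order_qpow_shift assms)

text \<open>
  Away from the origin a common zero of all the dilates is controlled by \<open>order_chain_prod_shift\<close>;
  at the origin the derivatives lose up to \<open>\<mu>\<close> orders, so this sharper bound is required.
\<close>
lemma order_0_chain_prod:
  assumes "q \<noteq> 0"
  shows "order 0 (chain_prod q (\<lambda>n. n - \<mu>) M) \<le> order 0 (chain_prod q (\<lambda>n. n) M) - \<mu>"
proof (induction M)
  case (add x M)
  then show ?case
    by (cases x) (auto simp: order_mult order_qpow_0[OF assms])
qed simp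

lemma qpow_mono_dvd: "n \<le> k \<Longrightarrow> qpow q w n dvd qpow q w k"
  unfolding qpow_def by (rule prod_dvd_prod_subset) auto

lemma chain_prod_mono_dvd:
  assumes "\<And>n. h n \<le> h' n"
  shows "chain_prod q h M dvd chain_prod q h' M"
  by (induction M) (auto intro!: mult_dvd_mono qpow_mono_dvd assms)

section \<open>Existence of the q-chain factorization\<close>

lemma qfactors_chain_prod:
  assumes "qfactors q P M"
  obtains A where "A \<noteq> 0" "P = smult A (chain_prod q (\<lambda>n. n) M)"
proof -
  from assms have "\<exists>A. A \<noteq> 0 \<and> P = smult A (chain_prod q (\<lambda>n. n) M)"
    by induction (auto simp: mult.commute)
  with that show thesis by blast
qed

text \<open>
  At a nonzero point the q-weight counts consecutive zeros along the orbit under multiplication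
  by \<open>q\<close>: \<open>D f\<close> vanishes at a point exactly when \<open>f\<close> takes equal values there and at the next
  orbit point.
\<close>
lemma qderiv_funpow_vanish_iff:
  assumes "q \<noteq> 0" "q \<noteq> 1" "w \<noteq> 0"
  shows "(\<forall>k<n. (qderiv q ^^ k) f w = 0) \<longleftrightarrow> (\<forall>k<n. f (q ^ k * w) = 0)"
proof (induction n arbitrary: f)
  case (Suc n)
  have *: "qderiv q f (q ^ k * w) = 0 \<longleftrightarrow> f (q ^ Suc k * w) = f (q ^ k * w)" for k
    using assms by (simp add: qderiv_def mult.assoc)
  have "(\<forall>k<Suc n. (qderiv q ^^ k) f w = 0)
      \<longleftrightarrow> f w = 0 \<and> (\<forall>k<n. (qderiv q ^^ k) (qderiv q f) w = 0)"
    by (simp add: All_less_Suc2 funpow_Suc_right del: funpow.simps)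
  also have "\<dots> \<longleftrightarrow> f w = 0 \<and> (\<forall>k<n. f (q ^ Suc k * w) = f (q ^ k * w))"
    unfolding Suc.IH * ..
  also have "\<dots> \<longleftrightarrow> (\<forall>k<Suc n. f (q ^ k * w) = 0)"
  proof
    assume L: "f w = 0 \<and> (\<forall>k<n. f (q ^ Suc k * w) = f (q ^ k * w))"
    have "f (q ^ k * w) = 0" if "k < Suc n" for k
      using that by (induction k) (use L in auto)
    then show "\<forall>k<Suc n. f (q ^ k * w) = 0" by blast
  next
    assume R: "\<forall>k<Suc n. f (q ^ k * w) = 0"
    then have "f (q ^ k * w) = 0" if "k \<le> n" for k using that by auto
    from this[of 0] this show "f w = 0 \<and> (\<forall>k<n. f (q ^ Suc k * w) = f (q ^ k * w))"
      by (auto simp del: power_Suc)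
  qed
  finally show ?case .
qed simp

lemma qweight_eqI:
  assumes "q \<noteq> 0" "q \<noteq> 1" "w \<noteq> 0"
    and "\<And>k. k < n \<Longrightarrow> f (q ^ k * w) = 0" and "f (q ^ n * w) \<noteq> 0"
  shows "qweight q f w = enat n"
proof -
  have zero: "\<forall>k<n. (qderiv q ^^ k) f w = 0"
    using assms by (subst qderiv_funpow_vanish_iff) auto
  have "\<not> (\<forall>k<Suc n. (qderiv q ^^ k) f w = 0)"
    using assms by (subst qderiv_funpow_vanish_iff) auto
  with zero have nz: "(qderiv q ^^ n) f w \<noteq> 0" by (auto simp: less_Suc_eq)
  moreover have "(LEAST k. (qderiv q ^^ k) f w \<noteq> 0) = n"
    by (intro Least_equality nz) (use zero in \<open>meson not_le\<close>)
  ultimately show ?thesis by (auto simp: qweight_def)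
qed

lemma one_le_qweight:
  assumes "f z = 0"
  shows "enat 1 \<le> qweight q f z"
proof (cases "\<forall>k. (qderiv q ^^ k) f z = 0")
  case False
  then have "(qderiv q ^^ (LEAST k. (qderiv q ^^ k) f z \<noteq> 0)) f z \<noteq> 0"
    by (metis (mono_tags, lifting) LeastI_ex)
  then have "(LEAST k. (qderiv q ^^ k) f z \<noteq> 0) \<noteq> 0"
    using assms by (metis funpow_0)
  with False show ?thesis by (simp add: qweight_def)
qed (simp add: qweight_def)

lemma qpow_dvd:
  assumes "inj (\<lambda>k. q ^ k)" "w \<noteq> 0" and "\<And>k. k < n \<Longrightarrow> poly P (q ^ k * w) = 0"
  shows "qpow q w n dvd P"
  using assms(3)
proof (induction n)
  case (Suc n)
  then obtain R where R: "P = qpow q w n * R" by (auto elim: dvdE)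
  have "poly (qpow q w n) (q ^ n * w) \<noteq> 0"
    using assms(2) injD[OF assms(1), of n] by (auto simp: poly_qpow_eq_0_iff mult.commute)
  moreover have "poly P (q ^ n * w) = 0" using Suc.prems by simp
  ultimately have "poly R (w * q ^ n) = 0" using R by (simp add: mult.commute)
  then show ?case
    unfolding R qpow_Suc by (intro mult_dvd_mono) (simp_all add: poly_eq_0_iff_dvd)
qed (simp add: qpow_def)

lemma infinite_orbit_nonroot:
  assumes "inj (\<lambda>k. q ^ k)" "q \<noteq> 0" "w \<noteq> 0" "(P :: complex poly) \<noteq> 0"
  shows "\<exists>k. poly P (q ^ k * w) \<noteq> 0" "\<exists>k. poly P (w / q ^ k) \<noteq> 0"
proof -
  have "inj (\<lambda>k. q ^ k * w)" "inj (\<lambda>k. w / q ^ k)"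
    using assms by (auto simp: inj_on_def field_simps)
  then have "infinite (range (\<lambda>k. q ^ k * w))" "infinite (range (\<lambda>k. w / q ^ k))"
    by (simp_all add: finite_image_iff)
  moreover have "finite {x. poly P x = 0}" using assms(4) by (rule poly_roots_finite)
  ultimately have "\<not> range (\<lambda>k. q ^ k * w) \<subseteq> {x. poly P x = 0}"
      "\<not> range (\<lambda>k. w / q ^ k) \<subseteq> {x. poly P x = 0}"
    by (meson finite_subset)+
  then show "\<exists>k. poly P (q ^ k * w) \<noteq> 0" "\<exists>k. poly P (w / q ^ k) \<noteq> 0"
    by auto
qed

text \<open>
  Orbits are infinite because \<open>|q| \<noteq> 1\<close>, so every nonzero root lies in a finite run of
  consecutive roots; splitting off such a run, or the full power of \<open>z\<close>, lowers the degree. This guarantees that the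
  multiset picked in \<open>qzeros\<close> is an actual factorization.
\<close>
lemma qfactors_exists:
  assumes q: "q \<noteq> 0" "cmod q \<noteq> 1" and "P \<noteq> 0"
  shows "\<exists>M. qfactors q P M"
  using \<open>P \<noteq> 0\<close>
proof (induction "degree P" arbitrary: P rule: less_induct)
  case less
  have q1: "q \<noteq> 1" using q by auto
  have inj: "inj (\<lambda>k. q ^ k)" using q by (rule inj_power_complex)
  consider "degree P = 0" | "poly P 0 = 0" | "degree P \<noteq> 0" "poly P 0 \<noteq> 0" by blast
  then show ?case
  proof cases
    case 1
    then obtain A where "P = [:A:]" by (rule degree_eq_zeroE)
    with less.prems show ?thesis by (auto intro: qfactors.const)
  next
    case 2
    define n where "n = order 0 P"
    have "n > 0" using 2 less.prems by (simp add: n_def order_gt_0_iff)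
    obtain R where R: "P = qpow q 0 n * R"
      using order_1[of 0 P] by (auto simp: qpow_0_left n_def elim: dvdE)
    have "R \<noteq> 0" using R less.prems by auto
    moreover have "degree R < degree P"
      using \<open>n > 0\<close> \<open>R \<noteq> 0\<close> by (simp add: R degree_mult_eq)
    ultimately obtain M where "qfactors q R M" using less.hyps by blast
    then have "qfactors q P (add_mset (0, n) M)"
      by (rule qfactors.origin[OF less.prems 2 n_def[symmetric] R])
    then show ?thesis ..
  next
    case 3
    then obtain z where z: "poly P z = 0"
      using Fundamental_Theorem_Algebra.fundamental_theorem_of_algebra[of P] by (auto simp: constant_degree)
    have z0: "z \<noteq> 0" using z 3 by auto
    \<comment> \<open>Walk back from \<open>z\<close> by division by \<open>q\<close> to the start \<open>w\<close> of its run of consecutive zeros.\<close>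
    define j where "j = (LEAST j. poly P (z / q ^ j) \<noteq> 0)"
    have j: "poly P (z / q ^ j) \<noteq> 0"
      unfolding j_def by (rule LeastI_ex) (rule infinite_orbit_nonroot[OF inj q(1) z0 less.prems])
    then obtain j' where j': "j = Suc j'" using z by (cases j) auto
    define w where "w = z / q ^ j'"
    have "poly P w = 0"
      using not_less_Least[of j' "\<lambda>j. poly P (z / q ^ j) \<noteq> 0"] j' by (auto simp: j_def w_def)
    have "poly P (w / q) \<noteq> 0" using j j' by (simp add: w_def mult.commute)
    have w0: "w \<noteq> 0" using z0 q by (simp add: w_def)
    define n where "n = (LEAST n. poly P (q ^ n * w) \<noteq> 0)"
    have n: "poly P (q ^ n * w) \<noteq> 0"
      unfolding n_def by (rule LeastI_ex) (rule infinite_orbit_nonroot[OF inj q(1) w0 less.prems])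
    have below: "poly P (q ^ k * w) = 0" if "k < n" for k
      using not_less_Least[of k "\<lambda>n. poly P (q ^ n * w) \<noteq> 0"] that by (auto simp: n_def)
    have "n > 0" using n \<open>poly P w = 0\<close> by (cases n) auto
    obtain R where R: "P = qpow q w n * R"
      using qpow_dvd[OF inj w0 below] by (auto elim: dvdE)
    have "R \<noteq> 0" using R less.prems by auto
    moreover have "degree R < degree P"
      using \<open>n > 0\<close> \<open>R \<noteq> 0\<close> by (simp add: R degree_mult_eq)
    ultimately obtain M where M: "qfactors q R M" using less.hyps by blast
    have "poly R (q ^ n * w) \<noteq> 0" using n R by auto
    moreover have "qweight q (poly P) w = enat n"
      using below n by (intro qweight_eqI q q1 w0)
    ultimately have "qfactors q P (add_mset (w, n) M)"
      using \<open>poly P w = 0\<close> \<open>poly P (w / q) \<noteq> 0\<close> R M by (intro qfactors.chain)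
    then show ?thesis ..
  qed
qed

lemma qzeros_factorization:
  assumes "q \<noteq> 0" "cmod q \<noteq> 1" "P \<noteq> 0"
  obtains A where "A \<noteq> 0" "P = smult A (chain_prod q (\<lambda>n. n) (qzeros q P))"
  using qfactors_chain_prod someI_ex[OF qfactors_exists[OF assms]]
  unfolding qzeros_def by blast

section \<open>Degrees of the q-radicals\<close>

lemma qrad_trunc_eq:
  "qrad_trunc q \<mu> P = gcd (chain_prod q (\<lambda>n. n) (qzeros q P)) (chain_prod q (\<lambda>n. \<mu>) (qzeros q P))"
  by (simp add: qrad_trunc_def chain_prod_def)

lemma degree_qrad: "degree (qrad q P) = size (qzeros q P)"
proof -
  have "qrad q P = chain_prod q (\<lambda>n. 1) (qzeros q P)"
    by (simp add: qrad_def chain_prod_def qpow_def)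
  then show ?thesis by (simp add: degree_chain_prod case_prod_unfold)
qed

lemma degree_qrad_trunc_le: "degree (qrad_trunc q \<mu> P) \<le> \<mu> * degree (qrad q P)"
proof -
  have "degree (qrad_trunc q \<mu> P) \<le> degree (chain_prod q (\<lambda>n. \<mu>) (qzeros q P))"
    unfolding qrad_trunc_eq by (intro dvd_imp_degree_le) auto
  also have "\<dots> = \<mu> * degree (qrad q P)"
    by (simp add: degree_qrad degree_chain_prod case_prod_unfold)
  finally show ?thesis .
qed

text \<open>
  Each chain of length \<open>n\<close> splits into the first \<open>min n \<mu>\<close> factors and an excess of
  \<open>n - \<mu>\<close>. The product of the former divides both arguments of the gcd. The gcd may be strictly
  larger, as different chains can overlap, so only an inequality holds.
\<close>
lemma degree_le_qrad_trunc:
  assumes "q \<noteq> 0" "cmod q \<noteq> 1" "P \<noteq> 0"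
  shows "degree P \<le> degree (qrad_trunc q \<mu> P) + degree (chain_prod q (\<lambda>n. n - \<mu>) (qzeros q P))"
proof -
  let ?M = "qzeros q P"
  obtain A where A: "A \<noteq> 0" "P = smult A (chain_prod q (\<lambda>n. n) ?M)"
    using assms by (rule qzeros_factorization)
  have "degree P = degree (chain_prod q (\<lambda>n. n) ?M)"
    using arg_cong[OF A(2), of degree] A(1) by simp
  also have "\<dots> = (\<Sum>(w, n)\<in>#?M. min n \<mu> + (n - \<mu>))"
    unfolding degree_chain_prod by (rule arg_cong[where f = sum_mset]) (auto intro!: image_mset_cong)
  also have "\<dots> = degree (chain_prod q (\<lambda>n. min n \<mu>) ?M) + degree (chain_prod q (\<lambda>n. n - \<mu>) ?M)"
    by (simp add: degree_chain_prod case_prod_unfold sum_mset.distrib)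
  also have "chain_prod q (\<lambda>n. min n \<mu>) ?M dvd qrad_trunc q \<mu> P"
    unfolding qrad_trunc_eq by (intro gcd_greatest chain_prod_mono_dvd) auto
  then have "degree (chain_prod q (\<lambda>n. min n \<mu>) ?M) \<le> degree (qrad_trunc q \<mu> P)"
    by (rule dvd_imp_degree_le) (simp add: qrad_trunc_eq)
  finally show ?thesis by simp
qed

section \<open>Relatively q-prime polynomials\<close>

text \<open>
  Two one-element chains at \<open>z\<close> and \<open>q z\<close> merge into a chain of length two, so the linear
  factor belonging to \<open>z\<close> is a common q-divisor. For \<open>z = 0\<close> the conclusion excludes
  a common zero at the origin.
\<close>
lemma rel_qprime_no_adjacent_zeros:
  assumes "rel_qprime q (poly f) (poly g)" and "poly f z = 0" and "poly g (q * z) = 0"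
  shows False
proof -
  obtain F where F: "f = [:- z, 1:] * F"
    using assms(2) by (auto simp: poly_eq_0_iff_dvd elim: dvdE)
  obtain G where G: "g = [:- (q * z), 1:] * G"
    using assms(3) by (auto simp: poly_eq_0_iff_dvd elim: dvdE)
  have "common_qdivisor q (poly f) (poly g) z"
    unfolding common_qdivisor_def
  proof (intro exI conjI allI)
    show "enat 1 \<le> qweight q (poly f) z" "enat 1 \<le> qweight q (poly g) (q * z)"
      by (rule one_le_qweight, fact)+
    show "poly f x = poly (qpow q z 1) x * poly F x" for x
      by (simp add: F qpow_def algebra_simps)
    show "poly g x = poly (qpow q (q * z) 1) x * poly G x" for x
      by (simp add: G qpow_def algebra_simps)
    show "poly f x * poly g x = poly (qpow q z (1 + 1)) x * poly F x * poly G x" for x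
      by (simp add: F G qpow_def algebra_simps)
  qed (auto intro!: holomorphic_intros)
  with assms(1) show False by (auto simp: rel_qprime_def)
qed

lemma linear_power_dvd_pcompose:
  fixes f :: "complex poly"
  assumes "a \<noteq> 0" and "[:- (a * p), 1:] ^ e dvd f"
  shows "[:- p, 1:] ^ e dvd pcompose f [:0, a:]"
proof -
  obtain R where "f = [:- (a * p), 1:] ^ e * R" using assms(2) by (auto elim: dvdE)
  moreover have "pcompose (r ^ e) [:0, a:] = pcompose r [:0, a:] ^ e" for r
    by (induction e) (simp_all add: pcompose_mult pcompose_1)
  moreover have "pcompose [:- (a * p), 1:] [:0, a:] = smult a [:- p, 1:]"
    by (simp add: pcompose_pCons)
  ultimately have "pcompose f [:0, a:] = smult a [:- p, 1:] ^ e * pcompose R [:0, a:]"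
    by (simp only: pcompose_mult)
  then show ?thesis by (simp only: smult_power mult_smult_left) (intro dvd_smult dvd_triv_left)
qed

lemma coprime_linear_power_X:
  fixes p :: complex
  assumes "p \<noteq> 0"
  shows "coprime ([:- p, 1:] ^ e) [:0, 1:]"
proof -
  have "coprime [:- p, 1:] [:0, 1:]"
  proof (rule coprimeI)
    fix c assume "c dvd [:- p, 1:]" "c dvd [:0, 1:]"
    then have "c dvd [:0, 1:] - [:- p, 1:]" by (intro dvd_diff)
    then have "c dvd [:p:]" by simp
    moreover have "is_unit [:p:]" using assms by (simp add: is_unit_const_poly_iff dvd_field_iff)
    ultimately show "is_unit c" by (rule dvd_trans)
  qed
  then show ?thesis by simp
qed

lemma degree_le_of_order_le:
  fixes f g :: "complex poly"
  assumes "f \<noteq> 0" "g \<noteq> 0" and "\<And>p. order p f \<le> order p g"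
  shows "degree f \<le> degree g"
proof -
  have "proots f \<subseteq># proots g" using assms by (auto intro!: mset_subset_eqI)
  then have "size (proots f) \<le> size (proots g)" by (rule size_mset_mono)
  then show ?thesis by (simp add: size_proots_complex)
qed

lemma exists_root_of_prod:
  fixes f :: "nat \<Rightarrow> complex poly"
  assumes "finite I" "poly (\<Prod>i\<in>I. f i) z = 0"
  obtains i where "i \<in> I" "poly (f i) z = 0"
  using assms by (auto simp: poly_prod prod_zero_iff)

lemma order_prod_unique_root:
  fixes f :: "nat \<Rightarrow> complex poly"
  assumes "finite I" "j \<in> I" and "\<And>i. i \<in> I \<Longrightarrow> f i \<noteq> 0"
    and "\<And>i. i \<in> I \<Longrightarrow> i \<noteq> j \<Longrightarrow> poly (f i) z \<noteq> 0"
  shows "order z (\<Prod>i\<in>I. f i) = order z (f j)"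
proof -
  have "poly (\<Prod>i\<in>I - {j}. f i) z \<noteq> 0"
    using assms by (auto simp: poly_prod)
  then have "order z (\<Prod>i\<in>I - {j}. f i) = 0" by (rule order_0I)
  moreover have "f j * (\<Prod>i\<in>I - {j}. f i) \<noteq> 0" using assms by auto
  ultimately show ?thesis
    by (simp add: prod.remove[OF assms(1,2)] order_mult)
qed

text \<open>
  A common zero of two relatively q-prime polynomials is possible, but only when no neighbour on
  the orbit is a zero of either. Hence along a run of at least two consecutive zeros of the
  product, each zero forces the next one into the same factor, and no other factor vanishes
  anywhere on the run.
\<close>
lemma qchain_single_factor:
  fixes f :: "nat \<Rightarrow> complex poly"
  assumes "finite I"
    and prime: "\<And>i j. i \<in> I \<Longrightarrow> j \<in> I \<Longrightarrow> i \<noteq> j \<Longrightarrow> rel_qprime q (poly (f i)) (poly (f j))"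
    and m: "m \<ge> 2"
    and zero: "\<And>s. s < m \<Longrightarrow> poly (\<Prod>i\<in>I. f i) (q ^ s * p) = 0"
  obtains j where "j \<in> I"
    and "\<And>i s. i \<in> I \<Longrightarrow> i \<noteq> j \<Longrightarrow> s < m \<Longrightarrow> poly (f i) (q ^ s * p) \<noteq> 0"
proof -
  have adj: "i = j" if "i \<in> I" "j \<in> I" "poly (f i) (q ^ s * p) = 0" "poly (f j) (q ^ Suc s * p) = 0" for i j s
    using rel_qprime_no_adjacent_zeros[OF prime[OF that(1,2)] that(3)] that(4)
    by (auto simp: mult.assoc)
  obtain j where j: "j \<in> I" "poly (f j) (q ^ 0 * p) = 0"
    using exists_root_of_prod[OF assms(1) zero[of 0]] m by auto
  have chain: "poly (f j) (q ^ s * p) = 0" if "s < m" for s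
    using that
  proof (induction s)
    case (Suc s)
    obtain i where "i \<in> I" "poly (f i) (q ^ Suc s * p) = 0"
      using exists_root_of_prod[OF assms(1) zero[OF Suc.prems]] by blast
    with adj[of j i s] j Suc show ?case by auto
  qed (use j in simp)
  have "poly (f i) (q ^ s * p) \<noteq> 0" if "i \<in> I" "i \<noteq> j" "s < m" for i s
  proof
    assume z: "poly (f i) (q ^ s * p) = 0"
    show False
    proof (cases "Suc s < m")
      case True
      then show False using adj[of i j s] z chain[of "Suc s"] j that by blast
    next
      case False
      then obtain t where "s = Suc t" using m that by (cases s) auto
      then show False using adj[of j i t] z chain[of t] j that by simp
    qed
  qed
  with j that show thesis by blast
qed

section \<open>The q-analogue of the Mason-Stothers inequality\<close>

text \<open>
  The sum \<open>0 + 1 + \<dots> + (m - 1)\<close> is the degree lost by the q-derivatives in the rows of the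
  determinant \<open>W\<close>. Omitting the column \<open>f l\<close> bounds the degree of \<open>W\<close> by
  \<open>degree P - degree (f l)\<close> minus this sum, and \<open>T\<close> bounds it from below.
\<close>
theorem q_mason_stothers:
  fixes q :: complex and m :: nat and f :: "nat \<Rightarrow> complex poly"
  defines "I \<equiv> {1..m+1}" and "P \<equiv> \<Prod>i=1..m+1. f i"
  assumes q: "q \<noteq> 0" "cmod q \<noteq> 1" and m: "m \<ge> 2"
    and prime: "\<And>i j. i \<in> I \<Longrightarrow> j \<in> I \<Longrightarrow> i \<noteq> j \<Longrightarrow> rel_qprime q (poly (f i)) (poly (f j))"
    and sum: "(\<Sum>i=1..m. f i) = f (m + 1)"
    and indep: "\<And>c. (\<Sum>i=1..m. smult (c i) (f i)) = 0 \<Longrightarrow> \<forall>i\<in>{1..m}. c i = 0"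
    and l: "l \<in> I"
  shows "degree (f l) + (\<Sum>i<m. i) \<le> degree (qrad_trunc q (m - 1) P)"
proof -
  have q1: "q \<noteq> 1" using q by auto
  have P_def': "P = (\<Prod>i\<in>I. f i)" by (simp add: P_def I_def)
  have finI: "finite I" by (simp add: I_def)
  have shift: "(\<Sum>j<m. h (Suc j)) = (\<Sum>i=1..m. h i)" for h :: "nat \<Rightarrow> 'a :: comm_monoid_add"
    by (rule sum.reindex_bij_witness[of _ "\<lambda>i. i - 1" Suc]) auto
  define g where "g j = f (Suc j)" for j
  define W where "W = qwronskian q m g"
  have g_sum: "(\<Sum>j<m. g j) = f (m + 1)" unfolding g_def shift sum ..
  have nz: "f i \<noteq> 0" if "i \<in> I" for i
  proof
    assume fi: "f i = 0"
    show False
    proof (cases "i = m + 1")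
      case True
      with sum fi have "(\<Sum>k=1..m. smult 1 (f k)) = 0" by simp
      from bspec[OF indep[OF this], of 1] show False using m by simp
    next
      case False
      have "(\<Sum>k=1..m. smult (if k = i then 1 else 0) (f k)) = 0"
        by (intro sum.neutral) (auto simp: fi)
      from bspec[OF indep[OF this], of i] show False using that False by (simp add: I_def)
    qed
  qed
  have P0: "P \<noteq> 0" using nz finI by (simp add: P_def')
  have W0: "W \<noteq> 0" unfolding W_def
  proof (rule qwronskian_nonzero[OF q])
    fix c assume "(\<Sum>j<m. smult (c j) (g j)) = 0"
    then have "(\<Sum>i=1..m. smult (c (i - 1)) (f i)) = 0"
      using shift[of "\<lambda>i. smult (c (i - 1)) (f i)"] by (simp add: g_def)
    from indep[OF this] have "c (Suc j - 1) = 0" if "j < m" for j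
      by (rule bspec) (use that in auto)
    then show "\<forall>j<m. c j = 0" by simp
  qed
  \<comment> \<open>The functional equation allows any \<open>m\<close> of the \<open>m + 1\<close> polynomials to serve as columns.\<close>
  have swap: "W = qwronskian q m (g(k := f (m + 1)))" if "k < m" for k
    using qwronskian_sum_column[OF q(1) that, of g] by (simp add: W_def g_sum)
  have W_dvd: "d dvd W" if "j \<in> I" and d: "\<And>i. i < m \<Longrightarrow> d dvd (qdiff q ^^ i) (f j)" for d j
  proof (cases "j = m + 1")
    case True
    show ?thesis unfolding swap[of 0, OF order_less_le_trans[OF pos2 m]]
      using d True m by (intro dvd_qwronskian[of 0]) auto
  next
    case False
    then show ?thesis unfolding W_def
      using that by (intro dvd_qwronskian[of "j - 1"]) (auto simp: I_def g_def)
  qed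
  have W_degree: "degree W + (\<Sum>i<m. i) + degree (f l) \<le> degree P"
  proof -
    have "degree P = (\<Sum>i\<in>I. degree (f i))"
      unfolding P_def' using nz by (intro degree_prod_eq_sum_degree) auto
    also have "\<dots> = degree (f (m + 1)) + (\<Sum>j<m. degree (g j))"
      unfolding g_def shift[of "\<lambda>i. degree (f i)"] by (simp add: I_def)
    finally have degP: "degree P = degree (f (m + 1)) + (\<Sum>j<m. degree (g j))" .
    show ?thesis
    proof (cases "l = m + 1")
      case True
      then show ?thesis using degree_qwronskian[OF q(1), of m g] W0 degP by (simp add: W_def)
    next
      case False
      define k where "k = l - 1"
      have k: "k < m" "g k = f l" using False l by (auto simp: k_def g_def I_def)
      have "(\<Sum>j<m. degree ((g(k := f (m + 1))) j)) + degree (f l) = degree P"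
        using k by (simp add: degP sum.remove[of "{..<m}" k])
      then show ?thesis
        using degree_qwronskian[OF q(1), of m "g(k := f (m + 1))"] W0 swap[OF k(1)] by simp
    qed
  qed
  define T where "T = chain_prod q (\<lambda>n. n - (m - 1)) (qzeros q P)"
  obtain A where A: "A \<noteq> 0" "P = smult A (chain_prod q (\<lambda>n. n) (qzeros q P))"
    using q P0 by (rule qzeros_factorization)
  have order_P: "order z P = order z (chain_prod q (\<lambda>n. n) (qzeros q P))" for z
    using A by (metis order_smult)
  have "order p T \<le> order p W" for p
  proof (cases "order p T = 0")
    case False
    \<comment> \<open>The zero of \<open>T\<close> forces consecutive zeros of \<open>P\<close>, all in a single \<open>f j\<close>, whose column is then
      divisible by the required power.\<close>
    have "[:- p, 1:] ^ order p T dvd W"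
    proof (cases "p = 0")
      case True
      have e: "order p T \<le> order p P - (m - 1)"
        unfolding T_def order_P True using q(1) by (rule order_0_chain_prod)
      then have "order p P \<noteq> 0" using False by auto
      then have "poly P p = 0" by (simp add: order_root)
      then obtain j where j: "j \<in> I"
        "\<And>i s. i \<in> I \<Longrightarrow> i \<noteq> j \<Longrightarrow> s < m \<Longrightarrow> poly (f i) (q ^ s * p) \<noteq> 0"
        using qchain_single_factor[where f = f and p = p, OF finI prime m] True by (auto simp: P_def')
      have "order p P = order p (f j)"
        unfolding P_def' using j(2)[of _ 0] m by (intro order_prod_unique_root finI j(1) nz) auto
      then have "monom 1 (order p P) dvd f j"
        using True nz[OF j(1)] by (simp add: monom_1_dvd_iff)
      show ?thesis
      proof (rule W_dvd[OF j(1)])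
        fix i assume "i < m"
        have "monom 1 (order p T) dvd (monom 1 (order p P - i) :: complex poly)"
          using e \<open>i < m\<close> by (simp add: monom_1_dvd_iff' )
        also have "\<dots> dvd (qdiff q ^^ i) (f j)"
          using q(1) \<open>monom 1 (order p P) dvd f j\<close> by (rule monom_dvd_qdiff_funpow)
        finally show "[:- p, 1:] ^ order p T dvd (qdiff q ^^ i) (f j)"
          using True by (simp add: monom_altdef)
      qed
    next
      case p: False
      have e: "order p T \<le> order (q ^ s * p) P" if "s < m" for s
        unfolding T_def order_P using that by (intro order_chain_prod_shift q) auto
      have "poly P (q ^ s * p) = 0" if "s < m" for s
        using e[OF that] False by (simp add: order_root)
      then obtain j where j: "j \<in> I"
        "\<And>i s. i \<in> I \<Longrightarrow> i \<noteq> j \<Longrightarrow> s < m \<Longrightarrow> poly (f i) (q ^ s * p) \<noteq> 0"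
        using qchain_single_factor[where f = f and p = p, OF finI prime m] by (auto simp: P_def')
      have fj: "[:- p, 1:] ^ order p T dvd pcompose (f j) [:0, q ^ s:]" if "s < m" for s
      proof (rule linear_power_dvd_pcompose)
        have "order (q ^ s * p) P = order (q ^ s * p) (f j)"
          unfolding P_def' using j(2) that by (intro order_prod_unique_root finI j(1) nz) auto
        with e[OF that] show "[:- (q ^ s * p), 1:] ^ order p T dvd f j"
          by (simp add: order_divides)
      qed (use q in simp)
      show ?thesis
      proof (rule W_dvd[OF j(1)])
        fix i assume "i < m"
        then show "[:- p, 1:] ^ order p T dvd (qdiff q ^^ i) (f j)"
          by (intro dvd_qdiff_funpow[OF q(1) q1 coprime_linear_power_X[OF p]] fj) simp
      qed
    qed
    then show ?thesis using W0 by (simp add: order_divides)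
  qed simp
  then have "degree T \<le> degree W"
    using W0 by (intro degree_le_of_order_le) (auto simp: T_def)
  moreover have "degree P \<le> degree (qrad_trunc q (m - 1) P) + degree T"
    unfolding T_def using q P0 by (rule degree_le_qrad_trunc)
  ultimately show ?thesis using W_degree by linarith
qed

theorem theorem4p1:
  fixes q :: complex and m :: nat and f :: "nat \<Rightarrow> complex poly"
  assumes "q \<noteq> 0" and "cmod q \<noteq> 1"
    and "m \<ge> 2"
    and "\<And>i j. i \<in> {1..m+1} \<Longrightarrow> j \<in> {1..m+1} \<Longrightarrow> i \<noteq> j \<Longrightarrow> rel_qprime q (poly (f i)) (poly (f j))"
    and "(MIN i\<in>{1..m+1}. degree (f i)) \<ge> m - 1"
    and "(\<Sum>i=1..m. f i) = f (m + 1)"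
    and "\<And>c :: nat \<Rightarrow> complex. (\<Sum>i=1..m. smult (c i) (f i)) = 0 \<Longrightarrow> (\<forall>i\<in>{1..m}. c i = 0)"
  shows "real (MAX i\<in>{1..m+1}. degree (f i))
           \<le> real (degree (qrad_trunc q (m - 1) (\<Prod>i=1..m+1. f i))) - 1/2 * real m * (real m - 1)
       \<and> real (degree (qrad_trunc q (m - 1) (\<Prod>i=1..m+1. f i))) - 1/2 * real m * (real m - 1)
           \<le> (real m - 1) * real (degree (qrad q (\<Prod>i=1..m+1. f i))) - 1/2 * real m * (real m - 1)"
proof
  let ?P = "\<Prod>i=1..m+1. f i"
  have gauss: "real (\<Sum>i<m. i) = 1/2 * real m * (real m - 1)"
    by (induction m) (auto simp: field_simps)
  have "(MAX i\<in>{1..m+1}. degree (f i)) \<in> (\<lambda>i. degree (f i)) ` {1..m+1}"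
    by (intro Max_in) auto
  then obtain l where "l \<in> {1..m+1}" "(MAX i\<in>{1..m+1}. degree (f i)) = degree (f l)"
    by blast
  with q_mason_stothers[OF assms(1-4,6,7), of l]
  have "(MAX i\<in>{1..m+1}. degree (f i)) + (\<Sum>i<m. i) \<le> degree (qrad_trunc q (m - 1) ?P)"
    by simp
  then show "real (MAX i\<in>{1..m+1}. degree (f i))
      \<le> real (degree (qrad_trunc q (m - 1) ?P)) - 1/2 * real m * (real m - 1)"
    unfolding gauss[symmetric] by linarith
  have "real (degree (qrad_trunc q (m - 1) ?P)) \<le> real ((m - 1) * degree (qrad q ?P))"
    by (rule of_nat_mono) (rule degree_qrad_trunc_le)
  then show "real (degree (qrad_trunc q (m - 1) ?P)) - 1/2 * real m * (real m - 1)
      \<le> (real m - 1) * real (degree (qrad q ?P)) - 1/2 * real m * (real m - 1)"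
    using assms(3) by (simp add: of_nat_diff)
qed

end
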